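(* For every integer $m\ge 0$ let $d_3(m)$ denote the number of partitions of $m$ into distinct parts, all of size greater than $2$, with the convention $d_3(0)=1$. Then for all integers $n>4$, $$b_{2,2}(n)-b_{2,1}(n)=\sum_{i=0}^{n-5}d_3(i)-d_3(n-1).$$
   Context: A partition of a positive integer $n$ is a finite non-increasing sequence of positive integers $\lambda=(\lambda_1,\lambda_2,\ldots,\lambda_k)$ (the parts) with $\sum_i\lambda_i=n$. Its Young diagram is the left-justified array of boxes whose $i$-th row from the top has $\lambda_i$ boxes. The hook length of a box is the number of boxes directly to its right in the same row, plus the number of boxes directly below it in the same column, plus $1$ for the box itself. For an integer $t\ge 2$, a partition is $t$-regular if none of its parts is divisible by $t$. For integers $t\ge 2$ and $k\ge 1$, $b_{t,k}(n)$ denotes the total number of hooks of length $k$ (that is, boxes with hook length $k$), counted over all $t$-regular partitions of $n$. *)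

theory Defs
  imports Main
begin

text \<open>
  A partition of \<open>n\<close> is the list of its parts in non-increasing order; the empty list is the
  only partition of \<open>0\<close>.
\<close>

definition partitions :: "nat \<Rightarrow> nat list set" where
  "partitions n = {xs. sorted_wrt (\<ge>) xs \<and> (\<forall>x\<in>set xs. 0 < x) \<and> sum_list xs = n}"

lemma finite_partitions: "finite (partitions n)"
proof (rule finite_subset)
  have "length xs \<le> sum_list xs" if "\<forall>x\<in>set xs. 0 < x" for xs :: "nat list"
    using that by (induction xs) auto
  then show "partitions n \<subseteq> {xs. set xs \<subseteq> {..n} \<and> length xs \<le> n}"
    by (auto simp: partitions_def intro: member_le_sum_list)
  show "finite {xs. set xs \<subseteq> {..n} \<and> length xs \<le> n}"
    by (rule finite_lists_length_le) simp
qed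

text \<open>Boxes are pairs (row, column), both counted from \<open>0\<close>.\<close>

definition young_diagram :: "nat list \<Rightarrow> (nat \<times> nat) set" where
  "young_diagram xs = {(i, j). i < length xs \<and> j < xs ! i}"

definition hook_length :: "nat list \<Rightarrow> nat \<times> nat \<Rightarrow> nat" where
  "hook_length xs = (\<lambda>(i, j).
     card {j'. j < j' \<and> (i, j') \<in> young_diagram xs}
     + card {i'. i < i' \<and> (i', j) \<in> young_diagram xs} + 1)"

definition regular_partitions :: "nat \<Rightarrow> nat \<Rightarrow> nat list set" where
  "regular_partitions t n = {xs \<in> partitions n. \<forall>x\<in>set xs. \<not> t dvd x}"

definition b :: "nat \<Rightarrow> nat \<Rightarrow> nat \<Rightarrow> nat" where
  "b t k n = (\<Sum>xs\<in>regular_partitions t n. card {c \<in> young_diagram xs. hook_length xs c = k})"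

definition d3 :: "nat \<Rightarrow> nat" where
  "d3 m = card {xs \<in> partitions m. distinct xs \<and> (\<forall>x\<in>set xs. 2 < x)}"

end

theory Submission
  imports Defs "HOL-Library.Multiset" "HOL-Computational_Algebra.Formal_Power_Series"
begin

unbundle fps_syntax

text \<open>
  In a partition into odd parts, the boxes of hook length one are the corners, one for each part
  size. A box of hook length two either has arm one and leg zero, which happens once for each size
  other than \<open>1\<close> because different odd sizes differ by at least two, or it has arm zero and leg
  one, which happens once for each size that is repeated. The difference of the two counts is
  therefore the number of repeated sizes, minus one if \<open>1\<close> is a part.

  A pair of equal parts \<open>k\<close>, or a part \<open>1\<close>, can be removed from a partition. Let \<open>Q\<close> be the
  generating function of the partitions into odd parts. Summing over these partitions gives
  \<open>b 2 2 - b 2 1\<close> the generating function \<open>S - X * Q\<close>, where \<open>S\<close> is \<open>Q\<close> times the sum of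
  \<open>X ^ (2 * k)\<close> over the odd numbers \<open>k\<close>, that is, \<open>S = X\<^sup>2 * Q / (1 - X ^ 4)\<close>.

  By Euler's theorem \<open>Q\<close> also counts the partitions into distinct parts. If \<open>D\<close> counts those with
  all parts greater than two, choosing whether \<open>1\<close> and \<open>2\<close> occur gives
  \<open>Q = (1 + X) * (1 + X\<^sup>2) * D\<close>. Since \<open>1 - X ^ 4 = (1 - X) * (1 + X) * (1 + X\<^sup>2)\<close>, this turns
  \<open>S\<close> into \<open>X\<^sup>2 * D / (1 - X)\<close>, the series of the partial sums of \<open>D\<close> shifted by two. The series
  \<open>X * Q = (X + X\<^sup>2 + X\<^sup>3 + X ^ 4) * D\<close> cancels the top three terms of such a partial sum and
  leaves one term of \<open>D\<close> with a negative sign.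
\<close>

section \<open>Hook lengths one and two\<close>

definition hook_count :: "nat \<Rightarrow> nat list \<Rightarrow> nat" where
  "hook_count k xs = card {c \<in> young_diagram xs. hook_length xs c = k}"

lemma hook_length_Cons_0:
  assumes "j < x"
  shows "hook_length (x # xs) (0, j) = (x - j) + length (filter (\<lambda>y. j < y) xs)"
proof -
  have "{j'. j < j' \<and> (0, j') \<in> young_diagram (x # xs)} = {j<..<x}"
    by (auto simp: young_diagram_def)
  moreover have "{i'. 0 < i' \<and> (i', j) \<in> young_diagram (x # xs)}
      = Suc ` {i. i < length xs \<and> j < xs ! i}"
    by (auto simp: young_diagram_def image_iff gr0_conv_Suc)
  ultimately show ?thesis
    using assms by (simp add: hook_length_def card_image length_filter_conv_card)
qed

lemma hook_length_Cons_Suc: "hook_length (x # xs) (Suc i, j) = hook_length xs (i, j)"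
proof -
  have "{i'. Suc i < i' \<and> (i', j) \<in> young_diagram (x # xs)}
      = Suc ` {i'. i < i' \<and> (i', j) \<in> young_diagram xs}"
    by (auto simp: young_diagram_def image_iff Suc_less_eq2)
  then show ?thesis
    by (simp add: hook_length_def card_image) (simp add: young_diagram_def)
qed

lemma finite_young_diagram: "finite (young_diagram xs)"
proof -
  have "young_diagram xs = (SIGMA i:{..<length xs}. {..<xs ! i})"
    by (auto simp: young_diagram_def)
  then show ?thesis by simp
qed

text \<open>
  A new top row leaves the arms and legs of all boxes below it unchanged, so hooks can be counted
  by recursion on the list of parts. The parts greater than \<open>j\<close> below the new row form the leg of
  its box in column \<open>j\<close>.
\<close>

lemma hook_count_Cons:
  "hook_count k (x # xs)
     = card {j. j < x \<and> (x - j) + length (filter (\<lambda>y. j < y) xs) = k} + hook_count k xs"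
proof -
  let ?row = "{j. j < x \<and> (x - j) + length (filter (\<lambda>y. j < y) xs) = k}"
  let ?rest = "{c \<in> young_diagram xs. hook_length xs c = k}"
  have split: "{c \<in> young_diagram (x # xs). hook_length (x # xs) c = k}
      = Pair 0 ` ?row \<union> map_prod Suc id ` ?rest" (is "?L = ?R")
  proof (rule set_eqI)
    fix c :: "nat \<times> nat"
    obtain i j where c: "c = (i, j)" by (cases c)
    show "c \<in> ?L \<longleftrightarrow> c \<in> ?R"
    proof (cases i)
      case 0
      then show ?thesis
        by (auto simp: c young_diagram_def hook_length_Cons_0)
    next
      case (Suc i')
      then show ?thesis
        by (force simp: c young_diagram_def hook_length_Cons_Suc)
    qed
  qed
  have "card ?L = card (Pair (0::nat) ` ?row) + card (map_prod Suc id ` ?rest)"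
    unfolding split
    by (rule card_Un_disjoint) (auto simp: finite_young_diagram)
  also have "\<dots> = card ?row + card ?rest"
    by (simp add: card_image inj_on_def)
  finally show ?thesis
    by (simp add: hook_count_def)
qed

text \<open>
  Placing a part \<open>x\<close> above parts of size at most \<open>x\<close> creates a new corner exactly when none of
  them equals \<open>x\<close>.
\<close>

lemma hook_count_1:
  assumes "sorted_wrt (\<ge>) xs" "\<forall>x\<in>set xs. 0 < x"
  shows "hook_count 1 xs = card (set xs)"
  using assms
proof (induction xs)
  case Nil
  then show ?case by (simp add: hook_count_def young_diagram_def)
next
  case (Cons x xs)
  have "{j. j < x \<and> (x - j) + length (filter (\<lambda>y. j < y) xs) = 1}
      = (if x \<in> set xs then {} else {x - 1})"
  proof -
    have "x - 1 < y \<longleftrightarrow> y = x" if "y \<in> set xs" for y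
      using that Cons.prems by fastforce
    then have "filter (\<lambda>y. x - 1 < y) xs = [] \<longleftrightarrow> x \<notin> set xs"
      by (auto simp: filter_empty_conv)
    moreover have "j < x \<and> (x - j) + length (filter (\<lambda>y. j < y) xs) = 1
        \<longleftrightarrow> j = x - 1 \<and> filter (\<lambda>y. x - 1 < y) xs = []" for j
      using Cons.prems by (cases "j = x - 1") auto
    ultimately show ?thesis by auto
  qed
  then show ?case
    using Cons by (simp add: hook_count_Cons insert_absorb)
qed

text \<open>
  In a new top row of length \<open>x\<close> only the last two boxes can have hook length two. The last box has
  it when exactly one further part equals \<open>x\<close>, that is, when the size \<open>x\<close> is just becoming a
  repeated one. The box before it has it when no other part exceeds \<open>x - 2\<close>; by parity this means
  that \<open>x\<close> is a new size, and the box exists unless \<open>x = 1\<close>.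
\<close>

lemma hook_count_2_odd:
  assumes "sorted_wrt (\<ge>) xs" "\<forall>x\<in>set xs. odd x"
  shows "hook_count 2 xs + of_bool (1 \<in> set xs)
    = card (set xs) + card {x \<in> set xs. 2 \<le> count_list xs x}"
  using assms
proof (induction xs)
  case Nil
  then show ?case by (simp add: hook_count_def young_diagram_def)
next
  case (Cons x xs)
  have x: "odd x" "0 < x" using Cons.prems by (auto simp: odd_pos)
  have le: "y \<le> x" "odd y" if "y \<in> set xs" for y using Cons.prems that by auto
  define row where "row = {j. j < x \<and> (x - j) + length (filter (\<lambda>y. j < y) xs) = 2}"
  have last: "length (filter (\<lambda>y. x - 1 < y) xs) = count_list xs x"
    unfolding count_list_eq_length_filter
    by (rule arg_cong[of _ _ length], rule filter_cong) (use le x in force)+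
  have row_last: "x - 1 \<in> row \<longleftrightarrow> count_list xs x = 1"
    using x last by (simp add: row_def)
  have row_prev: "x - 2 \<in> row \<longleftrightarrow> x \<notin> set xs" if "x \<noteq> 1"
  proof -
    have "x > 2" using that x by presburger
    moreover have "y = x" if "y \<in> set xs" "x - 2 < y" for y
    proof -
      have "y = x \<or> y = x - 1" using le(1)[OF that(1)] that(2) by linarith
      then show ?thesis using le(2)[OF that(1)] x by auto
    qed
    ultimately show ?thesis by (auto simp: row_def filter_empty_conv)
  qed
  have "row \<subseteq> {x - 1} \<union> (if x = 1 then {} else {x - 2})"
    using x by (auto simp: row_def)
  then have row_eq: "row = (if count_list xs x = 1 then {x - 1} else {})
      \<union> (if x = 1 \<or> x \<in> set xs then {} else {x - 2})"
    using row_last row_prev by (cases "x = 1") (auto split: if_splits)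
  have card_row: "card row = of_bool (count_list xs x = 1) + of_bool (x \<noteq> 1 \<and> x \<notin> set xs)"
    unfolding row_eq using x by (auto simp: count_list_0_iff)
  have rep: "{y \<in> set (x # xs). 2 \<le> count_list (x # xs) y}
      = {y \<in> set xs. 2 \<le> count_list xs y} \<union> (if count_list xs x = 1 then {x} else {})"
  proof (rule set_eqI)
    fix y
    have "x \<in> set xs \<longleftrightarrow> 0 < count_list xs x"
      using count_list_0_iff[of xs x] by auto
    then show "y \<in> {y \<in> set (x # xs). 2 \<le> count_list (x # xs) y} \<longleftrightarrow>
        y \<in> {y \<in> set xs. 2 \<le> count_list xs y} \<union> (if count_list xs x = 1 then {x} else {})"
      by (cases "y = x") auto
  qed
  have card_rep: "card {y \<in> set (x # xs). 2 \<le> count_list (x # xs) y}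
      = card {y \<in> set xs. 2 \<le> count_list xs y} + of_bool (count_list xs x = 1)"
    unfolding rep by auto
  have IH: "hook_count 2 xs + of_bool (1 \<in> set xs)
    = card (set xs) + card {x \<in> set xs. 2 \<le> count_list xs x}"
    using Cons by simp
  show ?case
    unfolding card_rep hook_count_Cons row_def[symmetric] card_row
    using IH by (cases "x \<in> set xs"; cases "x = 1") (auto simp: insert_absorb)
qed

section \<open>Partitions as multisets and sets\<close>

text \<open>
  Forgetting the order of the parts makes it easy to remove a part: ordinary partitions become
  multisets, and partitions into distinct parts become finite sets.
\<close>

definition mpartitions :: "nat set \<Rightarrow> nat \<Rightarrow> nat multiset set" where
  "mpartitions A n = {M. set_mset M \<subseteq> A \<and> sum_mset M = n}"

lemma bij_betw_mset_mpartitions: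
  assumes "0 \<notin> A"
  shows "bij_betw mset {xs \<in> partitions n. set xs \<subseteq> A} (mpartitions A n)"
proof (rule bij_betw_byWitness[where f' = "\<lambda>M. rev (sorted_list_of_multiset M)"])
  have "rev (sorted_list_of_multiset (mset xs)) = xs" if "sorted_wrt (\<ge>) xs" for xs :: "nat list"
  proof -
    have "sorted (rev xs)" using that by (simp add: sorted_wrt_rev)
    then have "sorted_list_of_multiset (mset (rev xs)) = rev xs"
      by (simp add: sorted_sort_id del: mset_rev)
    then show ?thesis by simp
  qed
  then show "\<forall>xs\<in>{xs \<in> partitions n. set xs \<subseteq> A}. rev (sorted_list_of_multiset (mset xs)) = xs"
    by (simp add: partitions_def)
  show "\<forall>M\<in>mpartitions A n. mset (rev (sorted_list_of_multiset M)) = M" by simp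
  show "mset ` {xs \<in> partitions n. set xs \<subseteq> A} \<subseteq> mpartitions A n"
    by (auto simp: mpartitions_def partitions_def sum_mset_sum_list)
  have "sum_list (rev (sorted_list_of_multiset M)) = sum_mset M" for M :: "nat multiset"
    by (metis mset_rev mset_sorted_list_of_multiset sum_mset_sum_list)
  moreover have "sorted_wrt (\<ge>) (rev (sorted_list_of_multiset M))" for M :: "nat multiset"
    by (simp add: sorted_wrt_rev)
  ultimately show "(\<lambda>M. rev (sorted_list_of_multiset M)) ` mpartitions A n
      \<subseteq> {xs \<in> partitions n. set xs \<subseteq> A}"
    using assms by (auto simp: mpartitions_def partitions_def intro: gr0I)
qed

lemma finite_mpartitions: "0 \<notin> A \<Longrightarrow> finite (mpartitions A n)"
  using bij_betw_finite[OF bij_betw_mset_mpartitions, of A n] finite_partitions[of n] by auto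

text \<open>
  Subtracting the prescribed parts \<open>N\<close> is a bijection onto the partitions of the remainder. This
  serves for \<open>N = {#k#}\<close>, in the recursion for generating functions, and for \<open>N = {#k, k#}\<close>, in
  counting repeated sizes.
\<close>

lemma card_mpartitions_containing:
  assumes "set_mset N \<subseteq> A"
  shows "card {M \<in> mpartitions A n. N \<subseteq># M}
    = (if sum_mset N \<le> n then card (mpartitions A (n - sum_mset N)) else 0)"
proof (cases "sum_mset N \<le> n")
  case True
  have "{M \<in> mpartitions A n. N \<subseteq># M} = (+) N ` mpartitions A (n - sum_mset N)"
    using assms True by (force simp: mpartitions_def subset_mset.le_iff_add)
  then show ?thesis using True by (simp add: card_image)
next
  case False
  then have "{M \<in> mpartitions A n. N \<subseteq># M} = {}"
    by (auto simp: mpartitions_def subset_mset.le_iff_add)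
  then show ?thesis using False by (simp only: card.empty if_False)
qed

definition distinct_partitions :: "nat set \<Rightarrow> nat \<Rightarrow> nat set set" where
  "distinct_partitions A n = {S. finite S \<and> S \<subseteq> A \<and> \<Sum>S = n}"

lemma bij_betw_set_distinct_partitions:
  assumes "0 \<notin> A"
  shows "bij_betw set {xs \<in> partitions n. distinct xs \<and> set xs \<subseteq> A} (distinct_partitions A n)"
proof (rule bij_betw_byWitness[where f' = "\<lambda>S. rev (sorted_list_of_set S)"])
  have "rev (sorted_list_of_set (set xs)) = xs" if "sorted_wrt (\<ge>) xs" "distinct xs"
    for xs :: "nat list"
  proof -
    have "sorted_list_of_set (set (rev xs)) = rev xs"
      using that by (intro sorted_list_of_set.idem_if_sorted_distinct) (auto simp: sorted_wrt_rev)
    then show ?thesis by simp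
  qed
  then show "\<forall>xs\<in>{xs \<in> partitions n. distinct xs \<and> set xs \<subseteq> A}.
      rev (sorted_list_of_set (set xs)) = xs"
    by (simp add: partitions_def)
  show "\<forall>S\<in>distinct_partitions A n. set (rev (sorted_list_of_set S)) = S"
    by (simp add: distinct_partitions_def)
  show "set ` {xs \<in> partitions n. distinct xs \<and> set xs \<subseteq> A} \<subseteq> distinct_partitions A n"
    by (auto simp: distinct_partitions_def partitions_def distinct_sum_list_conv_Sum)
  have "sum_list (rev (sorted_list_of_set S)) = \<Sum>S" if "finite S" for S :: "nat set"
    using that by (simp add: distinct_sum_list_conv_Sum)
  moreover have "sorted_wrt (\<ge>) (rev (sorted_list_of_set S))" for S :: "nat set"
    by (simp add: sorted_wrt_rev)
  ultimately show "(\<lambda>S. rev (sorted_list_of_set S)) ` distinct_partitions A n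
      \<subseteq> {xs \<in> partitions n. distinct xs \<and> set xs \<subseteq> A}"
    using assms by (auto simp: distinct_partitions_def partitions_def intro: gr0I)
qed

lemma finite_distinct_partitions: "0 \<notin> A \<Longrightarrow> finite (distinct_partitions A n)"
  using bij_betw_finite[OF bij_betw_set_distinct_partitions, of A n] finite_partitions[of n] by auto

lemma card_distinct_partitions_containing:
  assumes "k \<notin> A"
  shows "card {S \<in> distinct_partitions (insert k A) n. k \<in> S}
    = (if k \<le> n then card (distinct_partitions A (n - k)) else 0)"
proof (cases "k \<le> n")
  case True
  have "bij_betw (insert k) (distinct_partitions A (n - k))
      {S \<in> distinct_partitions (insert k A) n. k \<in> S}"
  proof (rule bij_betw_byWitness[where f' = "\<lambda>S. S - {k}"])
    show "\<forall>S\<in>distinct_partitions A (n - k). insert k S - {k} = S"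
      using assms by (auto simp: distinct_partitions_def)
    show "\<forall>S\<in>{S \<in> distinct_partitions (insert k A) n. k \<in> S}. insert k (S - {k}) = S"
      by auto
    show "insert k ` distinct_partitions A (n - k)
        \<subseteq> {S \<in> distinct_partitions (insert k A) n. k \<in> S}"
    proof
      fix T assume "T \<in> insert k ` distinct_partitions A (n - k)"
      then obtain S where "T = insert k S" "finite S" "S \<subseteq> A" "\<Sum>S = n - k"
        by (auto simp: distinct_partitions_def)
      moreover from this have "k \<notin> S" using assms by blast
      ultimately show "T \<in> {S \<in> distinct_partitions (insert k A) n. k \<in> S}"
        using True by (auto simp: distinct_partitions_def)
    qed
    show "(\<lambda>S. S - {k}) ` {S \<in> distinct_partitions (insert k A) n. k \<in> S}
        \<subseteq> distinct_partitions A (n - k)"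
    proof
      fix T assume "T \<in> (\<lambda>S. S - {k}) ` {S \<in> distinct_partitions (insert k A) n. k \<in> S}"
      then obtain S where S: "T = S - {k}" "finite S" "S \<subseteq> insert k A" "\<Sum>S = n" "k \<in> S"
        by (auto simp: distinct_partitions_def)
      then have "k + \<Sum>T = n"
        using sum.remove[of S k "\<lambda>x. x"] by simp
      then show "T \<in> distinct_partitions A (n - k)"
        using S by (auto simp: distinct_partitions_def)
    qed
  qed
  then show ?thesis using True by (simp add: bij_betw_same_card)
next
  case False
  have "k \<le> \<Sum>S" if "finite S" "k \<in> S" for S using member_le_sum[of k S id] that by simp
  then have "{S \<in> distinct_partitions (insert k A) n. k \<in> S} = {}"
    using False by (auto simp: distinct_partitions_def)
  then show ?thesis using False by (simp only: card.empty if_False)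
qed

section \<open>Generating functions and Euler's theorem\<close>

definition partition_gf :: "nat set \<Rightarrow> int fps" where
  "partition_gf A = Abs_fps (\<lambda>n. int (card (mpartitions A n)))"

definition distinct_gf :: "nat set \<Rightarrow> int fps" where
  "distinct_gf A = Abs_fps (\<lambda>n. int (card (distinct_partitions A n)))"

text \<open>
  The partitions with parts in \<open>insert k A\<close> either avoid \<open>k\<close> or arise from another such partition
  by adding a part \<open>k\<close>. The factor \<open>1 - X ^ k\<close> stays on the left instead of becoming a
  denominator, since the coefficients are integers and do not form a field.
\<close>

lemma partition_gf_insert:
  assumes "0 \<notin> A" "0 < k" "k \<notin> A"
  shows "partition_gf (insert k A) * (1 - fps_X ^ k) = partition_gf A"
proof -
  have "partition_gf (insert k A) = partition_gf A + fps_X ^ k * partition_gf (insert k A)"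
  proof (rule fps_ext)
    fix n
    let ?Q = "mpartitions (insert k A) n"
    have "?Q = mpartitions A n \<union> {M \<in> ?Q. {#k#} \<subseteq># M}"
      by (auto simp: mpartitions_def)
    then have "card ?Q = card (mpartitions A n \<union> {M \<in> ?Q. {#k#} \<subseteq># M})"
      by (rule arg_cong)
    also have "\<dots> = card (mpartitions A n) + card {M \<in> ?Q. {#k#} \<subseteq># M}"
    proof (rule card_Un_disjoint)
      have "finite ?Q" using assms by (intro finite_mpartitions) auto
      then show "finite {M \<in> ?Q. {#k#} \<subseteq># M}" by simp
    qed (use assms finite_mpartitions[of A n] in \<open>auto simp: mpartitions_def\<close>)
    finally show "partition_gf (insert k A) $ n
        = (partition_gf A + fps_X ^ k * partition_gf (insert k A)) $ n"
      by (simp add: partition_gf_def fps_X_power_mult_nth card_mpartitions_containing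
          del: single_subset_iff)
  qed
  then show ?thesis by (simp add: algebra_simps)
qed

lemma distinct_gf_insert:
  assumes "0 \<notin> A" "0 < k" "k \<notin> A"
  shows "distinct_gf (insert k A) = (1 + fps_X ^ k) * distinct_gf A"
proof (rule fps_ext)
  fix n
  let ?Q = "distinct_partitions (insert k A) n"
  have "?Q = distinct_partitions A n \<union> {S \<in> ?Q. k \<in> S}"
    by (auto simp: distinct_partitions_def)
  then have "card ?Q = card (distinct_partitions A n \<union> {S \<in> ?Q. k \<in> S})"
    by (rule arg_cong)
  also have "\<dots> = card (distinct_partitions A n) + card {S \<in> ?Q. k \<in> S}"
  proof (rule card_Un_disjoint)
    have "finite ?Q" using assms by (intro finite_distinct_partitions) auto
    then show "finite {S \<in> ?Q. k \<in> S}" by simp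
  qed (use assms finite_distinct_partitions[of A n] in \<open>auto simp: distinct_partitions_def\<close>)
  finally show "distinct_gf (insert k A) $ n = ((1 + fps_X ^ k) * distinct_gf A) $ n"
    using assms
    by (simp add: distinct_gf_def distrib_right fps_X_power_mult_nth
        card_distinct_partitions_containing)
qed

lemma partition_gf_empty: "partition_gf {} = 1"
proof (rule fps_ext)
  have "mpartitions {} n = (if n = 0 then {{#}} else {})" for n
    by (auto simp: mpartitions_def)
  then show "partition_gf {} $ n = 1 $ n" for n
    by (simp add: partition_gf_def)
qed

lemma distinct_gf_empty: "distinct_gf {} = 1"
proof (rule fps_ext)
  have "distinct_partitions {} n = (if n = 0 then {{}} else {})" for n
    by (auto simp: distinct_partitions_def)
  then show "distinct_gf {} $ n = 1 $ n" for n
    by (simp add: distinct_gf_def)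
qed

lemma one_minus_X_power_neq_0: "0 < k \<Longrightarrow> (1 - fps_X ^ k :: int fps) \<noteq> 0"
proof
  assume "0 < k" and "(1 - fps_X ^ k :: int fps) = 0"
  then have "(1 - fps_X ^ k :: int fps) $ 0 = 0 $ 0" by metis
  then show False using \<open>0 < k\<close> by simp
qed

lemma partition_gf_Un:
  assumes "finite A" "0 \<notin> A" "0 \<notin> B" "A \<inter> B = {}"
  shows "partition_gf (A \<union> B) = partition_gf A * partition_gf B"
  using assms
proof (induction A rule: finite_induct)
  case empty
  then show ?case by (simp add: partition_gf_empty)
next
  case (insert k A)
  have "partition_gf (insert k A \<union> B) * (1 - fps_X ^ k) = partition_gf (A \<union> B)"
    using insert by (simp add: partition_gf_insert)
  also have "\<dots> = partition_gf (insert k A) * (1 - fps_X ^ k) * partition_gf B"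
    using insert by (simp add: partition_gf_insert)
  finally have "partition_gf (insert k A \<union> B) * (1 - fps_X ^ k)
      = (partition_gf (insert k A) * partition_gf B) * (1 - fps_X ^ k)"
    by (simp add: mult_ac)
  then show ?case
    using insert.prems one_minus_X_power_neq_0[of k] by simp
qed

text \<open>
  Every multiset splits uniquely into the set of elements of odd multiplicity and a multiset in
  which all multiplicities are even; pairing up the latter gives a multiset of doubled elements. On
  generating functions this is the factorisation
  \<open>1 - X ^ (2 * k) = (1 + X ^ k) * (1 - X ^ k)\<close>, applied to one element \<open>k\<close> at a time.
\<close>

lemma partition_gf_eq_distinct_times_doubled:
  assumes "finite A" "0 \<notin> A"
  shows "partition_gf A = distinct_gf A * partition_gf ((*) 2 ` A)"
  using assms
proof (induction A rule: finite_induct)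
  case empty
  then show ?case by (simp add: partition_gf_empty distinct_gf_empty)
next
  case (insert k A)
  have k: "0 < k" "0 \<notin> A" using insert.prems by auto
  have pow: "(1 - fps_X ^ (2 * k) :: int fps) = (1 + fps_X ^ k) * (1 - fps_X ^ k)"
    by (simp add: algebra_simps mult_2_right power_add)
  have dbl: "partition_gf ((*) 2 ` insert k A) * (1 - fps_X ^ (2 * k)) = partition_gf ((*) 2 ` A)"
  proof -
    have "0 \<notin> (*) 2 ` A" "2 * k \<notin> (*) 2 ` A" using k insert.hyps by auto
    then show ?thesis using partition_gf_insert[of "(*) 2 ` A" "2 * k"] k by simp
  qed
  have "partition_gf (insert k A) * (1 - fps_X ^ (2 * k)) = (1 + fps_X ^ k) * partition_gf A"
    unfolding pow partition_gf_insert[OF k(2,1) insert.hyps(2), symmetric] by (simp only: mult_ac)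
  also have "\<dots> = (1 + fps_X ^ k) * distinct_gf A * partition_gf ((*) 2 ` A)"
    using insert k by (simp add: mult_ac)
  also have "\<dots> = distinct_gf (insert k A) * partition_gf ((*) 2 ` insert k A)
      * (1 - fps_X ^ (2 * k))"
    unfolding dbl[symmetric] using k insert.hyps by (simp add: distinct_gf_insert mult_ac)
  finally show ?case
    using one_minus_X_power_neq_0[of "2 * k"] k by simp
qed

text \<open>
  Parts greater than \<open>n\<close> do not affect the coefficient of \<open>X ^ n\<close>. This transfers product formulas
  from finite sets of parts to infinite ones.
\<close>

lemma partition_gf_nth_cong:
  assumes "A \<inter> {..n} = B \<inter> {..n}"
  shows "partition_gf A $ n = partition_gf B $ n"
proof -
  have "x \<le> sum_mset M" if "x \<in># M" for x and M :: "nat multiset"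
    using that by (metis le_add1 mset_add sum_mset.add_mset)
  then have "mpartitions A n = mpartitions B n"
    using assms by (fastforce simp: mpartitions_def)
  then show ?thesis by (simp add: partition_gf_def)
qed

lemma distinct_gf_nth_cong:
  assumes "A \<inter> {..n} = B \<inter> {..n}"
  shows "distinct_gf A $ n = distinct_gf B $ n"
proof -
  have "x \<le> \<Sum>S" if "finite S" "x \<in> S" for x and S :: "nat set"
    using member_le_sum[of x S id] that by simp
  then have "distinct_partitions A n = distinct_partitions B n"
    using assms by (fastforce simp: distinct_partitions_def)
  then show ?thesis by (simp add: distinct_gf_def)
qed

lemma fps_mult_nth_cong:
  fixes f g f' g' :: "'a :: semiring_1 fps"
  assumes "\<And>i. i \<le> n \<Longrightarrow> f $ i = f' $ i" "\<And>i. i \<le> n \<Longrightarrow> g $ i = g' $ i"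
  shows "(f * g) $ n = (f' * g') $ n"
  using assms by (simp add: fps_mult_nth)

text \<open>
  Let \<open>E\<close> be the set of positive even numbers. The generating function of all partitions is the
  product of those for odd parts and for parts in \<open>E\<close>. It is also the product of the one for
  distinct parts and the one for doubled parts, and the doubles of all positive numbers again form
  \<open>E\<close>. Cancelling the common factor gives Euler's theorem.
\<close>

theorem euler_odd_distinct: "partition_gf {k. odd k} = distinct_gf {0<..}"
proof -
  let ?E = "{k::nat. even k \<and> 0 < k}"
  have "distinct_gf {0<..} * partition_gf ?E = partition_gf {k. odd k} * partition_gf ?E"
  proof (rule fps_ext)
    fix n
    have "(distinct_gf {0<..} * partition_gf ?E) $ n
        = (distinct_gf {1..n} * partition_gf ((*) 2 ` {1..n})) $ n"
      by (intro fps_mult_nth_cong distinct_gf_nth_cong partition_gf_nth_cong)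
         (auto simp: image_iff elim!: evenE)
    also have "\<dots> = partition_gf {1..n} $ n"
      by (simp add: partition_gf_eq_distinct_times_doubled[symmetric])
    also have "{1..n} = {k. odd k \<and> k \<le> n} \<union> {k. even k \<and> 0 < k \<and> k \<le> n}"
      by (auto simp: Suc_le_eq odd_pos)
    also have "partition_gf \<dots> $ n = (partition_gf {k. odd k \<and> k \<le> n}
        * partition_gf {k. even k \<and> 0 < k \<and> k \<le> n}) $ n"
      by (subst partition_gf_Un) auto
    also have "\<dots> = (partition_gf {k. odd k} * partition_gf ?E) $ n"
      by (intro fps_mult_nth_cong partition_gf_nth_cong) auto
    finally show "(distinct_gf {0<..} * partition_gf ?E) $ n
        = (partition_gf {k. odd k} * partition_gf ?E) $ n" .
  qed
  moreover have "partition_gf ?E \<noteq> 0"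
  proof
    assume "partition_gf ?E = 0"
    moreover have "partition_gf ?E $ 0 = partition_gf {} $ 0"
      by (rule partition_gf_nth_cong) auto
    ultimately show False by (simp add: partition_gf_empty)
  qed
  ultimately show ?thesis by simp
qed

lemma odd_partition_gf_eq:
  "partition_gf {k. odd k} = (1 + fps_X) * (1 + fps_X ^ 2) * distinct_gf {2<..}"
proof -
  have "{0<..} = insert 1 (insert 2 {2<..} :: nat set)" by (auto simp: set_eq_iff)
  then show ?thesis
    by (simp add: euler_odd_distinct distinct_gf_insert mult_ac)
qed

lemma d3_eq: "int (d3 n) = distinct_gf {2<..} $ n"
proof -
  have "{xs \<in> partitions n. distinct xs \<and> set xs \<subseteq> {2<..}}
      = {xs \<in> partitions n. distinct xs \<and> (\<forall>x\<in>set xs. 2 < x)}" by auto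
  then show ?thesis
    using bij_betw_same_card[OF bij_betw_set_distinct_partitions[of "{2<..}" n]]
    by (simp add: d3_def distinct_gf_def)
qed

section \<open>Summing over the partitions into odd parts\<close>

text \<open>
  The repeated sizes of a partition are counted by exchanging the sums over partitions and over
  sizes \<open>k\<close>: the partitions containing two parts \<open>k\<close> correspond to all partitions of
  \<open>n - 2 * k\<close> into odd parts, and those containing \<open>1\<close> to all such partitions of \<open>n - 1\<close>.
\<close>

lemma b_difference:
  "int (b 2 2 n) - int (b 2 1 n)
     = (\<Sum>k | odd k \<and> k \<le> n. if 2 * k \<le> n then partition_gf {k. odd k} $ (n - 2 * k) else 0)
       - (if 1 \<le> n then partition_gf {k. odd k} $ (n - 1) else 0)"
proof -
  let ?O = "{k::nat. odd k}"
  have reg: "regular_partitions 2 n = {xs \<in> partitions n. set xs \<subseteq> ?O}"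
    by (auto simp: regular_partitions_def)
  have bij: "bij_betw mset (regular_partitions 2 n) (mpartitions ?O n)"
    unfolding reg by (rule bij_betw_mset_mpartitions) simp
  have fin: "finite (mpartitions ?O n)" by (rule finite_mpartitions) simp
  have le: "k \<le> n" if "k \<in># M" "M \<in> mpartitions ?O n" for k M
    using that by (auto simp: mpartitions_def dest!: multi_member_split)
  have "int (b 2 2 n) - int (b 2 1 n)
      = (\<Sum>xs\<in>regular_partitions 2 n. int (hook_count 2 xs) - int (hook_count 1 xs))"
    by (simp add: b_def hook_count_def sum_subtractf)
  also have "\<dots> = (\<Sum>xs\<in>regular_partitions 2 n.
      int (card {k \<in> set_mset (mset xs). 2 \<le> count (mset xs) k}) - of_bool (1 \<in># mset xs))"
  proof (rule sum.cong[OF refl])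
    fix xs assume "xs \<in> regular_partitions 2 n"
    then have "sorted_wrt (\<ge>) xs" "\<forall>x\<in>set xs. odd x" "\<forall>x\<in>set xs. 0 < x"
      by (auto simp: regular_partitions_def partitions_def)
    from hook_count_2_odd[OF this(1,2)] hook_count_1[OF this(1,3)]
    show "int (hook_count 2 xs) - int (hook_count 1 xs)
        = int (card {k \<in> set_mset (mset xs). 2 \<le> count (mset xs) k}) - of_bool (1 \<in># mset xs)"
      by (auto simp: count_mset)
  qed
  also have "\<dots> = (\<Sum>M\<in>mpartitions ?O n.
      int (card {k \<in> set_mset M. 2 \<le> count M k}) - of_bool (1 \<in># M))"
    by (rule sum.reindex_bij_betw[OF bij])
  also have "\<dots> = (\<Sum>M\<in>mpartitions ?O n. \<Sum>k | odd k \<and> k \<le> n. of_bool ({#k, k#} \<subseteq># M))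
      - int (card {M \<in> mpartitions ?O n. {#1#} \<subseteq># M})"
  proof -
    have "int (card {k \<in> set_mset M. 2 \<le> count M k})
        = (\<Sum>k | odd k \<and> k \<le> n. of_bool ({#k, k#} \<subseteq># M))" if "M \<in> mpartitions ?O n" for M
    proof -
      have two: "{#k, k#} \<subseteq># M \<longleftrightarrow> 2 \<le> count M k" for k
        by (auto simp: subseteq_mset_def)
      have "{k \<in> set_mset M. 2 \<le> count M k} = {k. odd k \<and> k \<le> n} \<inter> {k. {#k, k#} \<subseteq># M}"
      proof -
        have "odd k \<and> k \<le> n" if "2 \<le> count M k" for k
        proof -
          have "k \<in># M" using that by (simp flip: count_greater_zero_iff)
          then show ?thesis
            using le \<open>M \<in> mpartitions ?O n\<close> by (auto simp: mpartitions_def)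
        qed
        moreover have "k \<in># M" if "2 \<le> count M k" for k
          using that by (simp flip: count_greater_zero_iff)
        ultimately show ?thesis unfolding two by blast
      qed
      then show ?thesis by (simp add: Int_def)
    qed
    moreover have "(\<Sum>M\<in>mpartitions ?O n. of_bool (1 \<in># M))
        = int (card {M \<in> mpartitions ?O n. {#1#} \<subseteq># M})"
      using fin by (simp add: Int_def)
    ultimately show ?thesis by (simp add: sum_subtractf)
  qed
  also have "(\<Sum>M\<in>mpartitions ?O n. \<Sum>k | odd k \<and> k \<le> n. of_bool ({#k, k#} \<subseteq># M))
      = (\<Sum>k | odd k \<and> k \<le> n. int (card {M \<in> mpartitions ?O n. {#k, k#} \<subseteq># M}))"
    using fin by (subst sum.swap) (simp add: Int_def)
  also have "\<dots> = (\<Sum>k | odd k \<and> k \<le> n.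
      if 2 * k \<le> n then partition_gf ?O $ (n - 2 * k) else 0)"
    by (rule sum.cong) (auto simp: card_mpartitions_containing partition_gf_def mult_2)
  also have "int (card {M \<in> mpartitions ?O n. {#1#} \<subseteq># M})
      = (if 1 \<le> n then partition_gf ?O $ (n - 1) else 0)"
    by (subst card_mpartitions_containing) (auto simp: partition_gf_def)
  finally show ?thesis .
qed

text \<open>
  This is the geometric series \<open>X\<^sup>2 + X ^ 6 + X ^ 10 + \<dots> = X\<^sup>2 / (1 - X ^ 4)\<close> multiplied by \<open>f\<close>;
  the recursion comes from separating \<open>k = 1\<close> and shifting the other odd \<open>k\<close> by two.
\<close>

lemma sum_shifted_by_twice_odd:
  fixes f :: "int fps"
  defines "S \<equiv> Abs_fps (\<lambda>n. \<Sum>k | odd k \<and> k \<le> n. if 2 * k \<le> n then f $ (n - 2 * k) else 0)"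
  shows "S * (1 - fps_X ^ 4) = fps_X ^ 2 * f"
proof -
  have S: "S $ n = (\<Sum>k | odd k \<and> 2 * k \<le> n. f $ (n - 2 * k))" for n
    unfolding S_def fps_nth_Abs_fps by (rule sum.mono_neutral_cong_right) auto
  have "S = fps_X ^ 2 * f + fps_X ^ 4 * S"
  proof (rule fps_ext)
    fix n
    let ?K = "\<lambda>n. {k::nat. odd k \<and> 2 * k \<le> n}"
    have fin: "finite (?K m)" for m by (rule finite_subset[of _ "{..m}"]) auto
    have three: "k = 1 \<or> (\<exists>j. k = j + 2 \<and> odd j)" if "odd k" for k :: nat
      using that by (cases k rule: nat.exhaust; presburger)
    show "S $ n = (fps_X ^ 2 * f + fps_X ^ 4 * S) $ n"
    proof (cases "n < 2")
      case True
      then have "?K n = {}" by (auto elim!: oddE)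
      then show ?thesis using True by (simp only: S) (simp add: fps_X_power_mult_nth)
    next
      case False
      have K: "?K n = insert 1 ((\<lambda>j. j + 2) ` {j. odd j \<and> 2 * j + 4 \<le> n})"
      proof (rule set_eqI)
        fix k
        show "k \<in> ?K n \<longleftrightarrow> k \<in> insert 1 ((\<lambda>j. j + 2) ` {j. odd j \<and> 2 * j + 4 \<le> n})"
        proof (cases "odd k")
          case True
          then show ?thesis using three[OF True] False by (auto simp: image_iff)
        qed auto
      qed
      have "finite {j::nat. odd j \<and> 2 * j + 4 \<le> n}"
        by (rule finite_subset[of _ "{..n}"]) auto
      then have "S $ n = f $ (n - 2)
          + (\<Sum>k\<in>(\<lambda>j. j + 2) ` {j. odd j \<and> 2 * j + 4 \<le> n}. f $ (n - 2 * k))"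
        unfolding S K by (subst sum.insert) auto
      also have "(\<Sum>k\<in>(\<lambda>j. j + 2) ` {j. odd j \<and> 2 * j + 4 \<le> n}. f $ (n - 2 * k))
          = (\<Sum>j | odd j \<and> 2 * j + 4 \<le> n. f $ (n - 2 * (j + 2)))"
        by (subst sum.reindex) (auto simp: inj_on_def)
      also have "(\<Sum>j | odd j \<and> 2 * j + 4 \<le> n. f $ (n - 2 * (j + 2))) = (fps_X ^ 4 * S) $ n"
      proof (cases "n < 4")
        case True
        then have "{j::nat. odd j \<and> 2 * j + 4 \<le> n} = {}" by auto
        then show ?thesis using True by (simp only:) (simp add: fps_X_power_mult_nth)
      next
        case False
        then show ?thesis
          by (auto simp: fps_X_power_mult_nth S intro!: sum.cong arg_cong[of _ _ "fps_nth f"])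
      qed
      finally show ?thesis using False by (simp add: fps_X_power_mult_nth)
    qed
  qed
  then show ?thesis by (simp add: algebra_simps)
qed

theorem corollary1p5:
  fixes n :: nat
  assumes "n > 4"
  shows "int (b 2 2 n) - int (b 2 1 n) = (\<Sum>i=0..n-5. int (d3 i)) - int (d3 (n - 1))"
proof -
  define D where "D = distinct_gf {2<..}"
  define Q where "Q = partition_gf {k. odd k}"
  define S where
    "S = Abs_fps (\<lambda>n. \<Sum>k | odd k \<and> k \<le> n. if 2 * k \<le> n then Q $ (n - 2 * k) else 0)"
  let ?c = "(1 + fps_X) * (1 + fps_X ^ 2) :: int fps"
  have Q: "Q = ?c * D" by (simp add: Q_def D_def odd_partition_gf_eq)
  have "S * (1 - fps_X) * ?c = S * (1 - fps_X ^ 4)"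
    by (simp add: algebra_simps power2_eq_square power3_eq_cube power4_eq_xxxx)
  also have "\<dots> = fps_X ^ 2 * D * ?c"
    unfolding S_def sum_shifted_by_twice_odd Q by (simp add: mult_ac)
  finally have "S * (1 - fps_X) * ?c = fps_X ^ 2 * D * ?c" .
  moreover have "?c \<noteq> 0"
  proof
    assume "?c = 0"
    then have "?c $ 0 = 0 $ 0" by metis
    then show False by simp
  qed
  ultimately have "S * (1 - fps_X) = fps_X ^ 2 * D" using mult_right_cancel by blast
  then have S_rec: "S = fps_X * S + fps_X ^ 2 * D" by (simp add: algebra_simps)
  have S: "S $ (m + 2) = (\<Sum>i\<le>m. D $ i)" for m
  proof (induction m)
    case 0
    have "S $ 0 = 0" "S $ 1 = 0" "S $ 2 = S $ 1 + D $ 0"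
      by (subst S_rec, simp add: fps_X_power_mult_nth)+
    then show ?case by (simp add: numeral_2_eq_2)
  next
    case (Suc m)
    have "S $ (Suc m + 2) = S $ (m + 2) + D $ (m + 1)"
      by (subst S_rec) (simp add: fps_X_power_mult_nth)
    then show ?case using Suc by simp
  qed
  obtain m where n: "n = m + 5" using assms less_imp_Suc_add[of 4 n] by auto
  have "int (b 2 2 n) - int (b 2 1 n) = S $ n - Q $ (n - 1)"
    unfolding b_difference S_def Q_def using assms by simp
  also have "Q = D + fps_X ^ 1 * D + fps_X ^ 2 * D + fps_X ^ 3 * D"
    unfolding Q by (simp add: algebra_simps power2_eq_square power3_eq_cube power4_eq_xxxx)
  also have "\<dots> $ (n - 1) = D $ (m + 4) + D $ (m + 3) + D $ (m + 2) + D $ (m + 1)"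
    by (simp only: n fps_add_nth fps_X_power_mult_nth) (simp add: add.commute)
  also have "S $ n = (\<Sum>i\<le>m. D $ i) + D $ (m + 1) + D $ (m + 2) + D $ (m + 3)"
    using S[of "m + 3"] by (simp add: n eval_nat_numeral add.commute)
  finally show ?thesis
    by (simp add: n d3_eq D_def atLeast0AtMost add.commute)
qed

end
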